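(* Let $\sigma>0$ and let $\boldsymbol V\in C^1([0,\infty),\mathbb{R}^2)$ be periodic with period $1$, i.e. $\boldsymbol V(t+1)=\boldsymbol V(t)$ for all $t\ge 0$, with $\|\dot{\boldsymbol V}\|_{C[0,1]}\neq 0$. Consider the system $$\dot{\boldsymbol u}=\boldsymbol F(t,\boldsymbol u),\qquad \boldsymbol F(t,\boldsymbol u)=-\sigma\frac{\boldsymbol u}{|\boldsymbol u|}-\dot{\boldsymbol V}(t),\qquad \boldsymbol u\in\mathbb{R}^2 .$$ Then this system has a $1$-periodic generalized solution $\boldsymbol u(t)$ in the sense of Filippov, i.e. a generalized solution $\boldsymbol u:[0,\infty)\to\mathbb{R}^2$ with $\boldsymbol u(t+1)=\boldsymbol u(t)$ for all $t\ge 0$.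
   Context: $|\cdot|$ is the Euclidean norm, $\mu$ is Lebesgue measure in $\mathbb{R}^m$, $B_\delta(x)=\{y\in\mathbb{R}^m : |y-x|<\delta\}$, and $\operatorname{conv}U$ denotes the closed convex hull of $U\subset\mathbb{R}^m$, i.e. the intersection of all closed convex sets containing $U$. Generalized solution (Filippov): let $D\subset\mathbb{R}^m$ be a domain and $f:[t_1,t_2]\times D\to\mathbb{R}^m$ be Lebesgue measurable. An absolutely continuous function $x:[t_1,t_2]\to D$ is a generalized solution of $\dot x=f(t,x)$ if for almost all $t\in[t_1,t_2]$ $$\dot x(t)\in\bigcap_{\delta>0}\ \bigcap_{N:\ \mu(N)=0}\operatorname{conv} f\bigl(t,B_\delta(x(t))\setminus N\bigr),$$ where the inner intersection is over all measurable $N\subset\mathbb{R}^m$ with $\mu(N)=0$, and $f(t,B_\delta(x(t))\setminus N)$ is the image of $B_\delta(x(t))\setminus N$ under $x\mapsto f(t,x)$ with $t$ fixed. A function on $[0,\infty)$ is a generalized solution if its restriction to every compact interval $[t_1,t_2]\subset[0,\infty)$ is one. Here $m=2$ and $D=\mathbb{R}^2$. The right-hand side $\boldsymbol F$ is undefined at $\boldsymbol u=0$; it may be assigned arbitrary (measurable in $t$) values there, and this choice does not affect the definition, since $\{0\}$ is a null set. *)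

theory Defs
  imports "HOL-Analysis.Analysis"
begin

definition closed_convex_hull :: "'a::real_normed_vector set \<Rightarrow> 'a set" where
  "closed_convex_hull U = (\<lambda>S. closed S \<and> convex S) hull U"

text \<open>Absolute continuity of a function on a compact interval. A finite family of
  non-overlapping subintervals is given as a finite set of pairs of end points. (The library's
  \<open>absolutely_continuous\<close> is the unrelated notion for measures.)\<close>

definition abs_continuous_on_interval ::
    "real \<Rightarrow> real \<Rightarrow> (real \<Rightarrow> 'a::real_normed_vector) \<Rightarrow> bool" where
  "abs_continuous_on_interval a b x \<longleftrightarrow>
     (\<forall>\<epsilon>>0. \<exists>\<delta>>0. \<forall>I :: (real \<times> real) set.
        finite I \<longrightarrow>
        (\<forall>(s, t)\<in>I. a \<le> s \<and> s \<le> t \<and> t \<le> b) \<longrightarrow>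
        pairwise (\<lambda>(s, t) (s', t'). disjnt {s<..<t} {s'<..<t'}) I \<longrightarrow>
        (\<Sum>(s, t)\<in>I. t - s) < \<delta> \<longrightarrow>
        (\<Sum>(s, t)\<in>I. norm (x t - x s)) < \<epsilon>)"

text \<open>The intersection with \<open>D\<close> only accounts for HOL functions being total: \<open>f t\<close> is meaningful
  on \<open>D\<close> only. As \<open>D\<close> is open, the ball lies in \<open>D\<close> for all small \<open>\<delta>\<close>.\<close>

definition filippov_set ::
    "'a::euclidean_space set \<Rightarrow> (real \<Rightarrow> 'a \<Rightarrow> 'a) \<Rightarrow> real \<Rightarrow> 'a \<Rightarrow> 'a set" where
  "filippov_set D f t y =
     (\<Inter>\<delta>\<in>{0<..}. \<Inter>N\<in>null_sets lebesgue. closed_convex_hull (f t ` (ball y \<delta> \<inter> D - N)))"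

text \<open>The standing requirements on \<open>D\<close> and \<open>f\<close> are part of the predicate.\<close>

definition generalized_solution_on ::
    "real \<Rightarrow> real \<Rightarrow> 'a::euclidean_space set \<Rightarrow> (real \<Rightarrow> 'a \<Rightarrow> 'a) \<Rightarrow> (real \<Rightarrow> 'a) \<Rightarrow> bool" where
  "generalized_solution_on t1 t2 D f x \<longleftrightarrow>
     open D \<and> connected D \<and> D \<noteq> {} \<and>
     (\<lambda>(t, y). f t y) \<in> borel_measurable (lebesgue_on ({t1..t2} \<times> D)) \<and>
     x ` {t1..t2} \<subseteq> D \<and>
     abs_continuous_on_interval t1 t2 x \<and>
     (AE t in lebesgue_on {t1..t2}.
        \<exists>v. (x has_vector_derivative v) (at t within {t1..t2}) \<and> v \<in> filippov_set D f t (x t))"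

definition generalized_solution ::
    "'a::euclidean_space set \<Rightarrow> (real \<Rightarrow> 'a \<Rightarrow> 'a) \<Rightarrow> (real \<Rightarrow> 'a) \<Rightarrow> bool" where
  "generalized_solution D f x \<longleftrightarrow>
     (\<forall>t1 t2. 0 \<le> t1 \<and> t1 < t2 \<longrightarrow> generalized_solution_on t1 t2 D f x)"

text \<open>\<open>V'\<close> stands for the derivative of \<open>V\<close>; \<open>c\<close> is the arbitrary value assigned at the
  discontinuity \<open>u = 0\<close>.\<close>

definition rhs_F ::
    "real \<Rightarrow> (real \<Rightarrow> real^2) \<Rightarrow> (real \<Rightarrow> real^2) \<Rightarrow> real \<Rightarrow> real^2 \<Rightarrow> real^2" where
  "rhs_F \<sigma> V' c t u = (if u = 0 then c t else - \<sigma> *\<^sub>R (u /\<^sub>R norm u) - V' t)"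

end

theory Submission
  imports Defs "HOL-Complex_Analysis.Great_Picard"
begin

text \<open>The substitution \<open>w = u + V\<close> turns the equation into \<open>w' = - \<sigma> *\<^sub>R sgn (w - V)\<close>: the point \<open>w\<close> chases
  the moving point \<open>V\<close> with speed \<open>\<sigma>\<close>. In this form a ball around the origin that contains the closed
  curve \<open>V\<close> is invariant, since \<open>w\<close> always moves towards a point of the ball. A Brouwer fixed point of
  the period map is therefore to be expected, but the right-hand side is discontinuous. So the
  argument is carried out for a discrete pursuit (\<open>periodic_pursuit_exists\<close>), which moves in steps of
  length \<open>\<sigma> / N\<close> and stops at the target instead of overshooting it; this makes the period map
  continuous. All discrete pursuits obey the same speed limit up to one step, so a subsequence
  converges to a periodic curve \<open>w\<close> that is Lipschitz with constant \<open>\<sigma>\<close> and satisfies the equation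
  whenever \<open>w t \<noteq> V t\<close> (\<open>periodic_pursuit_curve_exists\<close>).

  Let \<open>u = w - V\<close>. Where \<open>u t \<noteq> 0\<close> the right-hand side is continuous in \<open>u\<close>, and its value belongs to the
  Filippov set. At the zeros of \<open>u\<close> the limit procedure gives no equation, but none is needed. A
  Lipschitz function has derivative \<open>0\<close> at almost all of its zeros, because almost all points of a
  closed set are points at which the set is not porous (\<open>Lipschitz_has_derivative_0_at_ae_zero\<close>).
  At such a zero \<open>w' = V'\<close>, and the speed limit on \<open>w\<close> yields \<open>norm (V' t) \<le> \<sigma>\<close>. This is exactly the
  condition for the derivative \<open>0\<close> to lie in the Filippov set at the origin, a ball of radius \<open>\<sigma>\<close>
  around \<open>- V' t\<close> (\<open>zero_in_filippov_set_rhs_F\<close>).\<close>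

section \<open>Discrete pursuit of a periodic target\<close>

text \<open>One step of length at most \<open>h\<close> from \<open>x\<close> straight towards \<open>v\<close>, not overshooting \<open>v\<close>.
  Equivalently this is the resolvent of \<open>h\<close> times the subdifferential of the distance to \<open>v\<close>;
  taking \<open>max\<close> in the denominator makes the cap at \<open>v\<close> visibly continuous in \<open>x\<close>.\<close>

definition chase :: "real \<Rightarrow> 'a::euclidean_space \<Rightarrow> 'a \<Rightarrow> 'a" where
  "chase h v x = x - (h / max h (norm (x - v))) *\<^sub>R (x - v)"

lemma chase_far:
  assumes "h > 0" "norm (x - v) \<ge> h"
  shows "chase h v x = x - h *\<^sub>R sgn (x - v)"
  using assms by (simp add: chase_def sgn_div_norm divide_inverse max_def)

lemma norm_chase_diff:
  assumes "h > 0"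
  shows "norm (chase h v x - x) \<le> h"
proof -
  have "norm (chase h v x - x) = h / max h (norm (x - v)) * norm (x - v)"
    using assms by (simp add: chase_def max_def)
  also have "\<dots> \<le> h"
    using assms by (simp add: max_def field_simps)
  finally show ?thesis .
qed

text \<open>The step lands on the segment from \<open>x\<close> to \<open>v\<close>, so balls are invariant.\<close>

lemma norm_chase_le:
  assumes "h > 0" "norm v \<le> R" "norm x \<le> R"
  shows "norm (chase h v x) \<le> R"
proof -
  define m where "m = h / max h (norm (x - v))"
  have m: "0 \<le> m" "m \<le> 1"
    using assms by (auto simp: m_def max_def divide_simps)
  have "chase h v x = (1 - m) *\<^sub>R x + m *\<^sub>R v"
    by (simp add: chase_def m_def algebra_simps)
  then have "chase h v x \<in> cball 0 R"
    using convexD[OF convex_cball[of 0 R], of x v "1 - m" m] assms m by auto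
  then show ?thesis by simp
qed

lemma continuous_on_chase:
  assumes "h > 0" "continuous_on S f"
  shows "continuous_on S (\<lambda>x. chase h v (f x))"
proof -
  have "max h r \<noteq> 0" for r using assms(1) by linarith
  then show ?thesis
    unfolding chase_def using assms by (intro continuous_intros) auto
qed

primrec pursuit :: "real \<Rightarrow> (nat \<Rightarrow> 'a::euclidean_space) \<Rightarrow> 'a \<Rightarrow> nat \<Rightarrow> 'a" where
  "pursuit h a x 0 = x"
| "pursuit h a x (Suc k) = chase h (a k) (pursuit h a x k)"

text \<open>The map sending a starting point to its position after one period of the targets is continuous
  and preserves the ball that contains all targets, so Brouwer's theorem gives a fixed point.\<close>

lemma periodic_pursuit_exists:
  fixes a :: "nat \<Rightarrow> 'a::euclidean_space"
  assumes h: "h > 0" and per: "\<And>k. a (k + N) = a k" and bdd: "\<And>k. norm (a k) \<le> R"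
  obtains x where "\<And>k. norm (x k) \<le> R" "\<And>k. x (k + N) = x k"
    "\<And>k. x (Suc k) = chase h (a k) (x k)"
proof -
  have cont: "continuous_on S (\<lambda>x. pursuit h a x k)" for S k
    by (induction k) (auto intro!: continuous_on_chase h continuous_intros)
  have bound: "norm (pursuit h a x k) \<le> R" if "norm x \<le> R" for x k
    by (induction k) (simp_all add: that norm_chase_le[OF h bdd])
  have "0 \<le> R" using bdd[of 0] norm_ge_zero order_trans by blast
  then obtain x where x: "x \<in> cball 0 R" "pursuit h a x N = x"
    using brouwer[OF compact_cball convex_cball _ cont, of 0 R N] bound by (auto simp: Pi_def)
  have "pursuit h a x (k + N) = pursuit h a x k" for k
    by (induction k) (auto simp: x per)
  with that[of "pursuit h a x"] bound x show thesis by auto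
qed

text \<open>The vector \<open>e\<close> is the common approximate step. It is \<open>0\<close> when a Lipschitz bound is wanted and the
  limiting velocity times the step size when the derivative of the limit is computed.\<close>

lemma steps_near_direction:
  fixes x :: "nat \<Rightarrow> 'a::real_normed_vector"
  assumes "\<And>k. min p q \<le> k \<Longrightarrow> k < max p q \<Longrightarrow> norm (x (Suc k) - x k - e) \<le> c"
  shows "norm (x q - x p - (real q - real p) *\<^sub>R e) \<le> \<bar>real q - real p\<bar> * c"
proof -
  have *: "norm (x j - x i - (real j - real i) *\<^sub>R e) \<le> (real j - real i) * c"
    if "i \<le> j" "\<And>k. i \<le> k \<Longrightarrow> k < j \<Longrightarrow> norm (x (Suc k) - x k - e) \<le> c" for i j
    using that
  proof (induction j rule: dec_induct)
    case base
    then show ?case by simp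
  next
    case (step j)
    have "x (Suc j) - x i - (real (Suc j) - real i) *\<^sub>R e
      = (x j - x i - (real j - real i) *\<^sub>R e) + (x (Suc j) - x j - e)"
      by (simp add: algebra_simps)
    also have "norm \<dots> \<le> (real j - real i) * c + c"
      by (intro norm_triangle_mono step) (use step in auto)
    finally show ?case by (simp add: algebra_simps)
  qed
  show ?thesis
  proof (cases "p \<le> q")
    case True
    then show ?thesis using *[of p q] assms by auto
  next
    case False
    have "x q - x p - (real q - real p) *\<^sub>R e = - (x p - x q - (real p - real q) *\<^sub>R e)"
      by (simp add: algebra_simps)
    with False *[of q p] assms show ?thesis by (simp only: norm_minus_cancel) auto
  qed
qed

section \<open>Periodic pursuit in continuous time\<close>

lemma abs_diff_nat_floor_le:
  "\<bar>real (nat \<lfloor>a\<rfloor>) - real (nat \<lfloor>b\<rfloor>)\<bar> \<le> \<bar>a - b\<bar> + 1"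
proof -
  have "\<bar>real (nat \<lfloor>a\<rfloor>) - real (nat \<lfloor>b\<rfloor>)\<bar> \<le> \<bar>real_of_int \<lfloor>a\<rfloor> - real_of_int \<lfloor>b\<rfloor>\<bar>"
    by (cases "0 \<le> \<lfloor>a\<rfloor>"; cases "0 \<le> \<lfloor>b\<rfloor>") (simp_all, linarith+)
  also have "\<dots> \<le> \<bar>a - b\<bar> + 1" by linarith
  finally show ?thesis .
qed

text \<open>A form of the Arzela-Ascoli theorem for functions that may jump, provided that the jumps vanish in
  the limit: after a diagonal choice on the rationals, the almost-Lipschitz bound transports
  convergence to every other point. It is meant for step functions, which spares interpolating the
  discrete pursuit.\<close>

lemma asymptotically_Lipschitz_convergent_subsequence:
  fixes f :: "nat \<Rightarrow> real \<Rightarrow> 'a::euclidean_space"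
  assumes bdd: "\<And>n t. norm (f n t) \<le> R"
    and lip: "\<And>n s t. norm (f n s - f n t) \<le> L * \<bar>s - t\<bar> + \<epsilon> n"
    and \<epsilon>: "\<epsilon> \<longlonglongrightarrow> 0" and L: "L > 0"
  obtains \<kappa> g where "strict_mono \<kappa>" "\<And>t. (\<lambda>n. f (\<kappa> n) t) \<longlonglongrightarrow> g t"
    "\<And>s t. norm (g s - g t) \<le> L * \<bar>s - t\<bar>"
proof -
  obtain \<kappa> where \<kappa>: "strict_mono (\<kappa> :: nat \<Rightarrow> nat)"
    and conv: "\<And>t. t \<in> \<rat> \<Longrightarrow> \<exists>l. (\<lambda>n. f (\<kappa> n) t) \<longlonglongrightarrow> l"
    using function_convergent_subsequence[OF countable_rat, of f R] bdd by blast
  have \<epsilon>\<kappa>: "(\<lambda>n. \<epsilon> (\<kappa> n)) \<longlonglongrightarrow> 0"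
    using LIMSEQ_subseq_LIMSEQ[OF \<epsilon> \<kappa>] by (simp add: o_def)
  have "Cauchy (\<lambda>n. f (\<kappa> n) t)" for t
  proof (rule metric_CauchyI)
    fix e :: real assume "e > 0"
    obtain q where q: "q \<in> \<rat>" "t - e / (8 * L) < q" "q < t"
      using Rats_dense_in_real[of "t - e / (8 * L)" t] \<open>e > 0\<close> L by auto
    have "L * (t - q) \<le> L * (e / (8 * L))" using q L by (intro mult_left_mono) auto
    then have Lq: "L * \<bar>t - q\<bar> \<le> e / 8" using L q by simp
    have "Cauchy (\<lambda>n. f (\<kappa> n) q)"
      using conv[OF q(1)] by (auto simp: intro: LIMSEQ_imp_Cauchy)
    then obtain M where M: "\<And>m n. m \<ge> M \<Longrightarrow> n \<ge> M \<Longrightarrow> dist (f (\<kappa> m) q) (f (\<kappa> n) q) < e / 4"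
      using \<open>e > 0\<close> by (metis metric_CauchyD divide_pos_pos zero_less_numeral)
    obtain M' where M': "\<And>n. n \<ge> M' \<Longrightarrow> \<epsilon> (\<kappa> n) < e / 8"
      using order_tendstoD(2)[OF \<epsilon>\<kappa>, of "e / 8"] \<open>e > 0\<close> by (auto simp: eventually_sequentially)
    have "dist (f (\<kappa> m) t) (f (\<kappa> n) t) < e" if "m \<ge> max M M'" "n \<ge> max M M'" for m n
    proof -
      have "dist (f (\<kappa> m) t) (f (\<kappa> n) t) \<le> dist (f (\<kappa> m) t) (f (\<kappa> m) q)
         + dist (f (\<kappa> m) q) (f (\<kappa> n) q) + dist (f (\<kappa> n) t) (f (\<kappa> n) q)"
        by (metis (no_types, opaque_lifting) add.assoc add_left_mono dist_commute dist_triangle order_trans)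
      moreover have "dist (f (\<kappa> m) t) (f (\<kappa> m) q) < e / 4" "dist (f (\<kappa> n) t) (f (\<kappa> n) q) < e / 4"
        using lip[of "\<kappa> m" t q] lip[of "\<kappa> n" t q] M'[of m] M'[of n] Lq that by (auto simp: dist_norm)
      moreover have "dist (f (\<kappa> m) q) (f (\<kappa> n) q) < e / 4"
        using M that by auto
      ultimately show ?thesis using \<open>e > 0\<close> by linarith
    qed
    then show "\<exists>M. \<forall>m\<ge>M. \<forall>n\<ge>M. dist (f (\<kappa> m) t) (f (\<kappa> n) t) < e" by blast
  qed
  then have "\<forall>t. \<exists>l. (\<lambda>n. f (\<kappa> n) t) \<longlonglongrightarrow> l"
    by (simp add: Cauchy_convergent_iff convergent_def)
  from choice[OF this] obtain g where g: "\<And>t. (\<lambda>n. f (\<kappa> n) t) \<longlonglongrightarrow> g t"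
    by blast
  have "norm (g s - g t) \<le> L * \<bar>s - t\<bar>" for s t
  proof (rule LIMSEQ_le)
    show "(\<lambda>n. norm (f (\<kappa> n) s - f (\<kappa> n) t)) \<longlonglongrightarrow> norm (g s - g t)"
      by (intro tendsto_intros g)
    show "(\<lambda>n. L * \<bar>s - t\<bar> + \<epsilon> (\<kappa> n)) \<longlonglongrightarrow> L * \<bar>s - t\<bar>"
      using tendsto_add[OF tendsto_const \<epsilon>\<kappa>] by simp
    show "\<exists>M. \<forall>n\<ge>M. norm (f (\<kappa> n) s - f (\<kappa> n) t) \<le> L * \<bar>s - t\<bar> + \<epsilon> (\<kappa> n)"
      using lip by blast
  qed
  with \<kappa> g that show thesis by blast
qed


lemma nat_floor_mult_div_tendsto:
  assumes "t \<ge> 0"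
  shows "(\<lambda>n. real (nat \<lfloor>t * real (Suc n)\<rfloor>) / real (Suc n)) \<longlonglongrightarrow> t"
proof (rule tendsto_sandwich)
  have fl: "t * real (Suc n) - 1 \<le> real (nat \<lfloor>t * real (Suc n)\<rfloor>)"
    "real (nat \<lfloor>t * real (Suc n)\<rfloor>) \<le> t * real (Suc n)" for n
    using assms by (simp_all add: of_nat_floor)
  have "t - 1 / real (Suc n) = (t * real (Suc n) - 1) / real (Suc n)" for n
    by (simp add: field_simps)
  then show "\<forall>\<^sub>F n in sequentially. t - 1 / real (Suc n) \<le> real (nat \<lfloor>t * real (Suc n)\<rfloor>) / real (Suc n)"
    using fl(1) by (intro always_eventually allI) (simp only: divide_right_mono of_nat_0_le_iff)
  show "\<forall>\<^sub>F n in sequentially. real (nat \<lfloor>t * real (Suc n)\<rfloor>) / real (Suc n) \<le> t"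
    using fl(2) by (intro always_eventually allI) (subst pos_divide_le_eq, simp_all only: of_nat_0_less_iff zero_less_Suc)
  show "(\<lambda>n. t - 1 / real (Suc n)) \<longlonglongrightarrow> t"
    using tendsto_diff[OF tendsto_const LIMSEQ_inverse_real_of_nat, of t]
    by (simp add: inverse_eq_divide)
qed simp

lemma periodic_continuous_bounded:
  fixes V :: "real \<Rightarrow> 'a::real_normed_vector"
  assumes "continuous_on {0..} V" and per: "\<And>t. t \<ge> 0 \<Longrightarrow> V (t + 1) = V t"
  obtains R where "\<And>t. t \<ge> 0 \<Longrightarrow> norm (V t) \<le> R"
proof -
  have shift: "V (s + real n) = V s" if "s \<ge> 0" for s n
  proof (induction n)
    case (Suc n)
    then show ?case using per[of "s + real n"] that by (simp add: add_ac)
  qed simp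
  have "compact (V ` {0..1})"
    using assms(1) by (intro compact_continuous_image) (auto intro: continuous_on_subset)
  then obtain R where R: "\<And>t. t \<in> {0..1} \<Longrightarrow> norm (V t) \<le> R"
    by (meson bounded_iff compact_imp_bounded imageI)
  have "norm (V t) \<le> R" if "t \<ge> 0" for t
  proof -
    have "t = frac t + real (nat \<lfloor>t\<rfloor>)" using that by (simp add: frac_def)
    then have "V t = V (frac t)" using shift[of "frac t"] by (metis frac_ge_0)
    then show ?thesis using R[of "frac t"] by (simp add: frac_lt_1 less_imp_le)
  qed
  then show thesis using that by blast
qed

text \<open>In the moving frame \<open>w = u + V\<close> the equation says that \<open>w\<close> chases \<open>V\<close> at speed \<open>\<sigma>\<close>, with no
  information about the velocity while \<open>w = V\<close>; there only the speed limit \<open>\<sigma>\<close> survives, and that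
  turns out to be enough. The curve is a limit of periodic discrete pursuits with \<open>n + 1\<close> steps per
  period. Near a time \<open>t0\<close> with \<open>w t0 \<noteq> V t0\<close>, all steps of the late approximations have full length
  and almost the same direction \<open>- sgn (w t0 - V t0)\<close>, because the approximations are uniformly
  almost Lipschitz and \<open>V\<close> is continuous. Adding up the steps determines the difference quotient of
  the limit.\<close>

lemma periodic_pursuit_curve_exists:
  fixes V :: "real \<Rightarrow> 'a::euclidean_space"
  assumes \<sigma>: "\<sigma> > 0" and cont: "continuous_on {0..} V"
    and per: "\<And>t. t \<ge> 0 \<Longrightarrow> V (t + 1) = V t"
  obtains w where "\<And>t. t \<ge> 0 \<Longrightarrow> w (t + 1) = w t"
    "\<And>s t. norm (w s - w t) \<le> \<sigma> * \<bar>s - t\<bar>"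
    "\<And>t. t \<ge> 0 \<Longrightarrow> w t \<noteq> V t \<Longrightarrow>
       (w has_vector_derivative - \<sigma> *\<^sub>R sgn (w t - V t)) (at t within {0..})"
proof -
  obtain R where R: "\<And>t. t \<ge> 0 \<Longrightarrow> norm (V t) \<le> R"
    using periodic_continuous_bounded[OF cont per] by blast
  define N where "N n = real (Suc n)" for n
  define h where "h n = \<sigma> / N n" for n
  have N: "N n > 0" for n by (simp add: N_def)
  have h: "h n > 0" for n using \<sigma> N by (simp add: h_def)
  have hN: "h n * N n = \<sigma>" for n using N[of n] by (simp add: h_def)
  have "\<exists>x. (\<forall>k. norm (x k) \<le> R) \<and> (\<forall>k. x (k + Suc n) = x k) \<and>
      (\<forall>k. x (Suc k) = chase (h n) (V (real k / N n)) (x k))" (is "\<exists>x. ?P n x") for n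
  proof (rule periodic_pursuit_exists[OF h[of n], of "\<lambda>k. V (real k / N n)" "Suc n" R])
    show "V (real (k + Suc n) / N n) = V (real k / N n)" for k
    proof -
      have "real (k + Suc n) / N n = real k / N n + 1"
        using N[of n] by (simp add: N_def field_simps)
      then show ?thesis using per N[of n] by simp
    qed
    show "norm (V (real k / N n)) \<le> R" for k using R N[of n] by simp
  qed blast
  then have "\<forall>n. \<exists>x. ?P n x" by blast
  from choice[OF this] obtain X where X: "\<And>n k. norm (X n k) \<le> R" "\<And>n k. X n (k + Suc n) = X n k"
      "\<And>n k. X n (Suc k) = chase (h n) (V (real k / N n)) (X n k)"
    by blast
  have step: "norm (X n j - X n i) \<le> \<bar>real j - real i\<bar> * h n" for n i j
    using steps_near_direction[of i j "X n" 0 "h n"] by (simp add: X(3) norm_chase_diff h)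
  define f where "f n t = X n (nat \<lfloor>t * N n\<rfloor>)" for n t
  have fR: "norm (f n t) \<le> R" for n t by (simp add: f_def X(1))
  have lip: "norm (f n s - f n t) \<le> \<sigma> * \<bar>s - t\<bar> + h n" for n s t
  proof -
    have "norm (f n s - f n t) \<le> (\<bar>s * N n - t * N n\<bar> + 1) * h n"
      unfolding f_def using step abs_diff_nat_floor_le h[of n]
      by (meson less_imp_le mult_right_mono order_trans)
    also have "\<bar>s * N n - t * N n\<bar> = \<bar>s - t\<bar> * N n"
      using N[of n] by (simp add: abs_mult flip: left_diff_distrib)
    also have "(\<bar>s - t\<bar> * N n + 1) * h n = \<sigma> * \<bar>s - t\<bar> + h n"
      using hN[of n] by (simp add: algebra_simps)
    finally show ?thesis .
  qed
  have h0: "h \<longlonglongrightarrow> 0"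
    unfolding h_def N_def using LIMSEQ_Suc[OF lim_const_over_n] by simp
  obtain \<kappa> w where \<kappa>: "strict_mono \<kappa>" and lim: "\<And>t. (\<lambda>n. f (\<kappa> n) t) \<longlonglongrightarrow> w t"
    and wlip: "\<And>s t. norm (w s - w t) \<le> \<sigma> * \<bar>s - t\<bar>"
    by (rule asymptotically_Lipschitz_convergent_subsequence[OF fR lip h0 \<sigma>]) (rule that)
  have "w (t + 1) = w t" if "t \<ge> 0" for t
  proof -
    have "f n (t + 1) = f n t" for n
    proof -
      have "(t + 1) * N n = t * N n + real (Suc n)" by (simp add: N_def algebra_simps)
      then have "nat \<lfloor>(t + 1) * N n\<rfloor> = nat \<lfloor>t * N n\<rfloor> + Suc n"
        using that N[of n] by (simp add: nat_add_distrib)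
      then show ?thesis unfolding f_def by (simp only: X(2))
    qed
    then show ?thesis using LIMSEQ_unique[OF lim[of "t + 1"]] lim[of t] by simp
  qed
  moreover have "(w has_vector_derivative - \<sigma> *\<^sub>R sgn (w t0 - V t0)) (at t0 within {0..})"
    if t0: "t0 \<ge> 0" and ne: "w t0 \<noteq> V t0" for t0
    unfolding has_vector_derivative_def has_derivative_within_alt
  proof (intro conjI allI impI)
    fix \<eta> :: real assume \<eta>: "\<eta> > 0"
    define u0 where "u0 = w t0 - V t0"
    have "u0 \<noteq> 0" using ne by (simp add: u0_def)
    then have "isCont sgn u0" by (simp add: isCont_def tendsto_sgn)
    then obtain \<rho>0 where "\<rho>0 > 0"
      and \<rho>0: "\<And>y. norm (y - u0) < \<rho>0 \<Longrightarrow> norm (sgn y - sgn u0) < \<eta> / \<sigma>"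
      unfolding continuous_at_eps_delta using \<eta> \<sigma> by (metis dist_norm divide_pos_pos)
    define \<rho> where "\<rho> = min \<rho>0 (norm u0 / 2)"
    have \<rho>: "\<rho> > 0" "\<rho> \<le> norm u0 / 2" using \<open>\<rho>0 > 0\<close> \<open>u0 \<noteq> 0\<close> by (auto simp: \<rho>_def)
    have near: "norm (sgn y - sgn u0) < \<eta> / \<sigma>" if "norm (y - u0) < \<rho>" for y
      using \<rho>0 that by (auto simp: \<rho>_def)
    obtain \<delta> where "\<delta> > 0"
      and \<delta>: "\<And>s. s \<ge> 0 \<Longrightarrow> \<bar>s - t0\<bar> < \<delta> \<Longrightarrow> norm (V s - V t0) < \<rho> / 4"
      using cont t0 \<rho> unfolding continuous_on_iff dist_norm real_norm_def
      by (metis atLeast_iff divide_pos_pos zero_less_numeral)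
    \<comment> \<open>The distance of an intermediate step to \<open>u0\<close> splits into the motion of the pursuer
      (below \<open>\<rho> / 4\<close>, namely \<open>\<sigma> * d\<close> plus one step), the error of the approximation at \<open>t0\<close>
      (below \<open>\<rho> / 8\<close>) and the motion of \<open>V\<close> (below \<open>\<rho> / 4\<close>).\<close>
    define d where "d = min \<delta> (\<rho> / (4 * \<sigma>)) / 2"
    have d: "d > 0" "2 * d \<le> \<delta>" using \<open>\<delta> > 0\<close> \<rho> \<sigma> by (auto simp: d_def)
    have "d \<le> \<rho> / (4 * \<sigma>) / 2" by (simp add: d_def)
    then have \<sigma>d: "\<sigma> * d \<le> \<rho> / 8" using \<sigma> by (simp add: field_simps)
    show "\<exists>d>0. \<forall>t\<in>{0..}. norm (t - t0) < d \<longrightarrow>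
        norm (w t - w t0 - (t - t0) *\<^sub>R (- \<sigma> *\<^sub>R sgn (w t0 - V t0))) \<le> \<eta> * norm (t - t0)"
    proof (intro exI[of _ d] conjI ballI impI)
      show "d > 0" by fact
      fix t :: real assume "t \<in> {0..}" and td: "norm (t - t0) < d"
      then have t: "t \<ge> 0" by simp
      \<comment> \<open>The time that the step function counts between \<open>t0\<close> and \<open>t\<close>, in whole steps.\<close>
      define D where
        "D n = real (nat \<lfloor>t * N n\<rfloor>) / N n - real (nat \<lfloor>t0 * N n\<rfloor>) / N n" for n
      have "D \<longlonglongrightarrow> t - t0"
        unfolding D_def N_def by (intro tendsto_diff nat_floor_mult_div_tendsto t t0)
      then have D: "(\<lambda>n. D (\<kappa> n)) \<longlonglongrightarrow> t - t0"
        using LIMSEQ_subseq_LIMSEQ[OF _ \<kappa>] by (auto simp: o_def)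
      have h\<kappa>: "(\<lambda>n. h (\<kappa> n)) \<longlonglongrightarrow> 0"
        using LIMSEQ_subseq_LIMSEQ[OF h0 \<kappa>] by (auto simp: o_def)
      have "\<forall>\<^sub>F n in sequentially. norm (f (\<kappa> n) t0 - w t0) < \<rho> / 8"
        using tendstoD[OF lim, of "\<rho> / 8" t0] \<rho> by (simp add: dist_norm)
      moreover have "\<forall>\<^sub>F n in sequentially. h (\<kappa> n) < min (\<rho> / 8) (\<sigma> * d)"
        by (rule order_tendstoD(2)[OF h\<kappa>]) (use \<rho> \<sigma> d in auto)
      ultimately have "\<forall>\<^sub>F n in sequentially.
          norm (f (\<kappa> n) t - f (\<kappa> n) t0 - D (\<kappa> n) *\<^sub>R (- \<sigma> *\<^sub>R sgn u0)) \<le> \<bar>D (\<kappa> n)\<bar> * \<eta>"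
      proof eventually_elim
        case (elim n)
        define m where "m = \<kappa> n"
        define p where "p = nat \<lfloor>t0 * N m\<rfloor>"
        define q where "q = nat \<lfloor>t * N m\<rfloor>"
        have hm: "h m < \<rho> / 8" "h m < \<sigma> * d" using elim(2) by (auto simp: m_def)
        have Nm: "1 / N m < d" using hm(2) \<sigma> N[of m] by (simp add: h_def field_simps)
        have pq: "real p \<le> t0 * N m" "t0 * N m < real p + 1"
          "real q \<le> t * N m" "t * N m < real q + 1"
          using t t0 N[of m] by (auto simp: p_def q_def of_nat_floor)
        have tt: "\<bar>t * N m - t0 * N m\<bar> = \<bar>t - t0\<bar> * N m"
          using N[of m] by (simp add: abs_mult flip: left_diff_distrib)
        have "norm (X m (Suc k) - X m k - (- h m *\<^sub>R sgn u0)) \<le> h m * (\<eta> / \<sigma>)"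
          if k: "min p q \<le> k" "k < max p q" for k
        proof -
          have k': "min (real p) (real q) \<le> real k" "real k + 1 \<le> max (real p) (real q)"
            using k by linarith+
          have "\<bar>real k - t0 * N m\<bar> \<le> \<bar>t * N m - t0 * N m\<bar> + 1"
            using k' pq by linarith
          then have "\<bar>real k - t0 * N m\<bar> / N m \<le> \<bar>t - t0\<bar> + 1 / N m"
            using N[of m] tt by (simp add: field_simps)
          moreover have "real k / N m - t0 = (real k - t0 * N m) / N m"
            using N[of m] by (simp add: diff_divide_distrib)
          then have "\<bar>real k / N m - t0\<bar> = \<bar>real k - t0 * N m\<bar> / N m"
            using N[of m] by (simp only: abs_divide abs_of_pos)
          ultimately have "\<bar>real k / N m - t0\<bar> < \<delta>"
            using td Nm d(2) by simp
          then have Vk: "norm (V (real k / N m) - V t0) < \<rho> / 4"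
            using \<delta> N[of m] by simp
          have "\<bar>real k - real p\<bar> \<le> \<bar>t - t0\<bar> * N m + 1"
            using k' pq tt by linarith
          then have "\<bar>real k - real p\<bar> * h m \<le> (\<bar>t - t0\<bar> * N m + 1) * h m"
            using h[of m] by (simp add: mult_right_mono)
          also have "\<dots> = \<sigma> * \<bar>t - t0\<bar> + h m"
            using hN[of m] by (simp add: algebra_simps)
          also have "\<sigma> * \<bar>t - t0\<bar> + h m < \<rho> / 4"
          proof -
            have "\<sigma> * \<bar>t - t0\<bar> < \<sigma> * d" using td \<sigma> by simp
            then show ?thesis using \<sigma>d hm(1) by linarith
          qed
          finally have Xk: "norm (X m k - X m p) < \<rho> / 4"
            using step[of m k p] by linarith
          have Xp: "norm (X m p - w t0) < \<rho> / 8"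
            using elim(1) by (simp add: f_def m_def p_def)
          define y where "y = X m k - V (real k / N m)"
          have "y - u0 = (X m k - X m p) + (X m p - w t0) - (V (real k / N m) - V t0)"
            by (simp add: y_def u0_def)
          then have "norm (y - u0) \<le> norm (X m k - X m p) + norm (X m p - w t0)
              + norm (V (real k / N m) - V t0)"
            by (metis (no_types, opaque_lifting) norm_triangle_ineq norm_triangle_ineq4
                add_right_mono order_trans)
          then have yu: "norm (y - u0) < \<rho>" using Xk Xp Vk \<rho>(1) by linarith
          have "norm u0 \<le> norm y + norm (y - u0)"
            by (metis norm_minus_commute norm_triangle_sub add.commute)
          \<comment> \<open>The pursuer is more than a step away from its target, so the cap is inactive.\<close>
          then have "norm y \<ge> h m" using yu \<rho> hm(1) by linarith
          then have "X m (Suc k) = X m k - h m *\<^sub>R sgn y"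
            using chase_far[OF h[of m]] by (simp add: X(3) y_def)
          then have "X m (Suc k) - X m k - (- h m *\<^sub>R sgn u0) = - (h m *\<^sub>R (sgn y - sgn u0))"
            by (simp add: algebra_simps)
          then have "norm (X m (Suc k) - X m k - (- h m *\<^sub>R sgn u0)) = h m * norm (sgn y - sgn u0)"
            using h[of m] by (simp only: norm_minus_cancel norm_scaleR)
          also have "\<dots> \<le> h m * (\<eta> / \<sigma>)"
            using near[OF yu] h[of m] by (intro mult_left_mono) auto
          finally show ?thesis .
        qed
        from steps_near_direction[of p q "X m", OF this]
        have main: "norm (X m q - X m p - (real q - real p) *\<^sub>R (- h m *\<^sub>R sgn u0))
            \<le> \<bar>real q - real p\<bar> * (h m * (\<eta> / \<sigma>))" .
        have qp: "(real q - real p) * h m = D m * \<sigma>"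
          using N[of m] by (simp add: D_def h_def p_def q_def field_simps)
        then have dir: "(real q - real p) *\<^sub>R (- h m *\<^sub>R sgn u0) = D m *\<^sub>R (- \<sigma> *\<^sub>R sgn u0)"
          by simp
        have "\<bar>real q - real p\<bar> * h m = \<bar>D m\<bar> * \<sigma>"
          using arg_cong[OF qp, of abs] h[of m] \<sigma> by (simp add: abs_mult)
        then have mag: "\<bar>real q - real p\<bar> * (h m * (\<eta> / \<sigma>)) = \<bar>D m\<bar> * \<eta>"
          using \<sigma> by (simp add: mult.assoc[symmetric])
        show ?case
          using main unfolding dir mag
          by (simp add: f_def m_def[symmetric] p_def[symmetric] q_def[symmetric])
      qed
      moreover have "(\<lambda>n. norm (f (\<kappa> n) t - f (\<kappa> n) t0 - D (\<kappa> n) *\<^sub>R (- \<sigma> *\<^sub>R sgn u0)))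
          \<longlonglongrightarrow> norm (w t - w t0 - (t - t0) *\<^sub>R (- \<sigma> *\<^sub>R sgn u0))"
        by (intro tendsto_intros lim D)
      moreover have "(\<lambda>n. \<bar>D (\<kappa> n)\<bar> * \<eta>) \<longlonglongrightarrow> \<bar>t - t0\<bar> * \<eta>"
        by (intro tendsto_intros D)
      ultimately have "norm (w t - w t0 - (t - t0) *\<^sub>R (- \<sigma> *\<^sub>R sgn u0)) \<le> \<bar>t - t0\<bar> * \<eta>"
        using tendsto_le[OF sequentially_bot] by blast
      then show "norm (w t - w t0 - (t - t0) *\<^sub>R (- \<sigma> *\<^sub>R sgn (w t0 - V t0))) \<le> \<eta> * norm (t - t0)"
        by (simp add: u0_def mult.commute)
    qed
  qed (rule bounded_linear_scaleR_left)
  ultimately show thesis using wlip that by blast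
qed

section \<open>Lipschitz functions on the line\<close>

lemma Lipschitz_imp_abs_continuous_on_interval:
  assumes lip: "\<And>s t. s \<in> {a..b} \<Longrightarrow> t \<in> {a..b} \<Longrightarrow> norm (x s - x t) \<le> L * \<bar>s - t\<bar>"
    and L: "L > 0"
  shows "abs_continuous_on_interval a b x"
  unfolding abs_continuous_on_interval_def
proof (intro allI impI)
  fix \<epsilon> :: real assume \<epsilon>: "\<epsilon> > 0"
  show "\<exists>\<delta>>0. \<forall>I. finite I \<longrightarrow> (\<forall>(s, t)\<in>I. a \<le> s \<and> s \<le> t \<and> t \<le> b) \<longrightarrow>
      pairwise (\<lambda>(s, t) (s', t'). disjnt {s<..<t} {s'<..<t'}) I \<longrightarrow>
      (\<Sum>(s, t)\<in>I. t - s) < \<delta> \<longrightarrow> (\<Sum>(s, t)\<in>I. norm (x t - x s)) < \<epsilon>"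
  proof (intro exI[of _ "\<epsilon> / L"] conjI allI impI)
    show "\<epsilon> / L > 0" using \<epsilon> L by simp
    fix I :: "(real \<times> real) set"
    assume I: "\<forall>(s, t)\<in>I. a \<le> s \<and> s \<le> t \<and> t \<le> b" and small: "(\<Sum>(s, t)\<in>I. t - s) < \<epsilon> / L"
    have "(\<Sum>(s, t)\<in>I. norm (x t - x s)) \<le> (\<Sum>(s, t)\<in>I. L * (t - s))"
    proof (rule sum_mono)
      fix i assume "i \<in> I"
      with I lip[of "snd i" "fst i"]
      show "(case i of (s, t) \<Rightarrow> norm (x t - x s)) \<le> (case i of (s, t) \<Rightarrow> L * (t - s))"
        by (cases i) auto
    qed
    also have "\<dots> = L * (\<Sum>(s, t)\<in>I. t - s)"
      by (simp add: sum_distrib_left case_prod_unfold)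
    also have "\<dots> < \<epsilon>" using small L by (simp add: field_simps)
    finally show "(\<Sum>(s, t)\<in>I. norm (x t - x s)) < \<epsilon>" .
  qed
qed

lemma norm_vector_derivative_le_Lipschitz:
  fixes f :: "real \<Rightarrow> 'a::real_normed_vector"
  assumes f: "(f has_vector_derivative v) (at t within S)" and t: "t islimpt S"
    and lip: "\<And>s. s \<in> S \<Longrightarrow> norm (f s - f t) \<le> L * \<bar>s - t\<bar>"
  shows "norm v \<le> L"
proof (rule field_le_epsilon)
  fix e :: real assume "e > 0"
  then obtain d where "d > 0"
    and d: "\<And>s. s \<in> S \<Longrightarrow> \<bar>s - t\<bar> < d \<Longrightarrow> norm (f s - f t - (s - t) *\<^sub>R v) \<le> e * \<bar>s - t\<bar>"
    using f unfolding has_vector_derivative_def has_derivative_within_alt real_norm_def by metis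
  then obtain s where s: "s \<in> S" "s \<noteq> t" "\<bar>s - t\<bar> < d"
    using t unfolding islimpt_approachable dist_real_def by blast
  have "\<bar>s - t\<bar> * norm v \<le> norm (f s - f t) + norm (f s - f t - (s - t) *\<^sub>R v)"
    using norm_triangle_ineq4[of "f s - f t" "f s - f t - (s - t) *\<^sub>R v"] by simp
  also have "\<dots> \<le> L * \<bar>s - t\<bar> + e * \<bar>s - t\<bar>"
    using lip[OF s(1)] d[OF s(1,3)] by simp
  finally have "\<bar>s - t\<bar> * norm v \<le> \<bar>s - t\<bar> * (L + e)" by (simp add: algebra_simps)
  then show "norm v \<le> L + e" using s(2) by simp
qed

lemma Lipschitz_if_vector_derivative_bounded:
  fixes f :: "real \<Rightarrow> 'a::real_normed_vector"
  assumes "convex S" and der: "\<And>t. t \<in> S \<Longrightarrow> (f has_vector_derivative f' t) (at t within S)"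
    and B: "\<And>t. t \<in> S \<Longrightarrow> norm (f' t) \<le> B" and st: "s \<in> S" "t \<in> S"
  shows "norm (f s - f t) \<le> B * \<bar>s - t\<bar>"
proof -
  have "norm (f s - f t) \<le> B * norm (s - t)"
  proof (rule differentiable_bound[OF \<open>convex S\<close> _ _ st])
    show "(f has_derivative (\<lambda>h. h *\<^sub>R f' x)) (at x within S)" if "x \<in> S" for x
      using der[OF that] by (simp add: has_vector_derivative_def)
    show "onorm (\<lambda>h. h *\<^sub>R f' x) \<le> B" if "x \<in> S" for x
      by (rule onorm_le) (use mult_right_mono[OF B[OF that] abs_ge_zero] in \<open>simp add: mult.commute\<close>)
  qed
  then show ?thesis by simp
qed

text \<open>A weak form of the Lebesgue density theorem, with the classical proof. Enclose \<open>Z\<close> in an open \<open>U\<close>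
  with \<open>U - Z\<close> small and choose disjoint balls in \<open>U\<close> that cover \<open>E\<close> up to a null set (Vitali), each
  containing a hole of \<open>Z\<close> of proportional size. The holes are disjoint and lie in \<open>U - Z\<close>, so the
  total size of the balls is at most \<open>1 / \<kappa>\<close> times the measure of \<open>U - Z\<close>.\<close>

lemma negligible_if_porous_in:
  fixes Z E :: "real set"
  assumes Z: "Z \<in> sets lebesgue" and "E \<subseteq> Z" and \<kappa>: "\<kappa> > 0"
    and por: "\<And>t d. t \<in> E \<Longrightarrow> d > 0 \<Longrightarrow>
      \<exists>r c. 0 < r \<and> r < d \<and> ball c (\<kappa> * r) \<subseteq> ball t r - Z"
  shows "negligible E"
  unfolding negligible_outer_le
proof (intro allI impI)
  fix e :: real assume "e > 0"
  obtain U where U: "open U" "Z \<subseteq> U" "U - Z \<in> lmeasurable"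
    and emU: "emeasure lebesgue (U - Z) < ennreal (e * \<kappa>)"
    using sets_lebesgue_outer_open[OF Z, of "e * \<kappa>"] \<open>e > 0\<close> \<kappa> by auto
  have mU: "measure lebesgue (U - Z) < e * \<kappa>"
    using emU emeasure_eq_measure2[OF U(3)] \<open>e > 0\<close> \<kappa> by (simp add: ennreal_less_iff)
  define K where "K = {(t, r). 0 < r \<and> ball t r \<subseteq> U \<and> (\<exists>c. ball c (\<kappa> * r) \<subseteq> ball t r - Z)}"
  have "\<exists>i. i \<in> K \<and> t \<in> ball (fst i) (snd i) \<and> snd i < d" if "t \<in> E" "d > 0" for t d
  proof -
    obtain \<rho> where "\<rho> > 0" "ball t \<rho> \<subseteq> U"
      using \<open>t \<in> E\<close> \<open>E \<subseteq> Z\<close> U by (meson openE subsetD)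
    moreover obtain r c where "0 < r" "r < min d \<rho>" "ball c (\<kappa> * r) \<subseteq> ball t r - Z"
      using por[OF \<open>t \<in> E\<close>, of "min d \<rho>"] \<open>d > 0\<close> \<open>\<rho> > 0\<close> by auto
    moreover from this have "ball t r \<subseteq> ball t \<rho>" by (simp add: subset_ball)
    ultimately have "(t, r) \<in> K" "t \<in> ball t r" "r < d"
      unfolding K_def by auto
    then show ?thesis by (metis fst_conv snd_conv)
  qed
  then obtain C where C: "countable C" "C \<subseteq> K"
    and disj: "pairwise (\<lambda>i j. disjnt (ball (fst i) (snd i)) (ball (fst j) (snd j))) C"
    and neg: "negligible (E - (\<Union>i\<in>C. ball (fst i) (snd i)))"
    by (rule Vitali_covering_theorem_balls[of E K fst snd]) (metis, blast)
  let ?B = "\<lambda>i. ball (fst i) (snd i) :: real set"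
  have bound: "measure lebesgue (\<Union>i\<in>I. ?B i) \<le> e" if "I \<subseteq> C" "finite I" for I
  proof -
    have disjI: "pairwise (\<lambda>i j. disjnt (?B i) (?B j)) I"
      using disj that(1) pairwise_subset by blast
    have each: "\<kappa> * measure lebesgue (?B i) \<le> measure lebesgue (?B i - Z)" if "i \<in> I" for i
    proof -
      obtain t r where i: "i = (t, r)" by fastforce
      with \<open>i \<in> I\<close> \<open>I \<subseteq> C\<close> C(2) obtain c where c: "0 < r" "ball c (\<kappa> * r) \<subseteq> ball t r - Z"
        unfolding K_def by blast
      have "\<kappa> * measure lebesgue (?B i) = measure lebesgue (ball c (\<kappa> * r))"
        using c(1) \<kappa> by (simp add: i content_ball unit_ball_vol_def ball_eq_greaterThanLessThan)
      also have "\<dots> \<le> measure lebesgue (?B i - Z)"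
        using c Z by (intro measure_mono_fmeasurable fmeasurable_Diff) (auto simp: i)
      finally show ?thesis .
    qed
    have "\<kappa> * measure lebesgue (\<Union>i\<in>I. ?B i) = (\<Sum>i\<in>I. \<kappa> * measure lebesgue (?B i))"
      using that disjI by (subst measure_UNION') (auto simp: sum_distrib_left)
    also have "\<dots> \<le> (\<Sum>i\<in>I. measure lebesgue (?B i - Z))"
      by (intro sum_mono each)
    also have "\<dots> = measure lebesgue (\<Union>i\<in>I. ?B i - Z)"
    proof (rule measure_UNION'[symmetric])
      show "pairwise (\<lambda>i j. disjnt (?B i - Z) (?B j - Z)) I"
        by (rule pairwise_mono[OF disjI]) (auto simp: disjnt_def)
    qed (use that Z in \<open>auto intro: fmeasurable_Diff\<close>)
    also have "\<dots> \<le> measure lebesgue (U - Z)"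
    proof (rule measure_mono_fmeasurable)
      show "(\<Union>i\<in>I. ?B i - Z) \<subseteq> U - Z"
        using that(1) C(2) unfolding K_def by fastforce
      show "(\<Union>i\<in>I. ?B i - Z) \<in> sets lebesgue"
        using that(2) Z by (intro sets.finite_UN) auto
    qed (rule U(3))
    finally have "\<kappa> * measure lebesgue (\<Union>i\<in>I. ?B i) \<le> e * \<kappa>" using mU by linarith
    then show ?thesis using \<kappa> by (simp add: mult.commute)
  qed
  have M: "(\<Union>i\<in>C. ?B i) \<in> lmeasurable" "measure lebesgue (\<Union>i\<in>C. ?B i) \<le> e"
    by (rule fmeasurable_UN_bound[OF C(1) _ bound] measure_UN_bound[OF C(1) _ bound]; simp)+
  have N: "E - (\<Union>i\<in>C. ?B i) \<in> lmeasurable" "measure lebesgue (E - (\<Union>i\<in>C. ?B i)) = 0"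
    using neg by (auto intro: negligible_imp_measurable negligible_imp_measure0)
  have "(E - (\<Union>i\<in>C. ?B i)) \<union> (\<Union>i\<in>C. ?B i) \<in> lmeasurable"
    using M(1) N(1) by blast
  moreover have "measure lebesgue ((E - (\<Union>i\<in>C. ?B i)) \<union> (\<Union>i\<in>C. ?B i)) \<le> e"
    using measure_Un_le[OF fmeasurableD[OF N(1)] fmeasurableD[OF M(1)]] M(2) N(2) by linarith
  moreover have "E \<subseteq> (E - (\<Union>i\<in>C. ?B i)) \<union> (\<Union>i\<in>C. ?B i)" by blast
  ultimately show "\<exists>T. E \<subseteq> T \<and> T \<in> lmeasurable \<and> measure lebesgue T \<le> e" by blast
qed

text \<open>A substitute for Rademacher's theorem at the zeros of \<open>f\<close>. If the derivative at a zero \<open>t\<close> is not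
  \<open>0\<close>, then there are points \<open>s\<close> arbitrarily close to \<open>t\<close> with \<open>norm (f s) > \<epsilon> * \<bar>s - t\<bar>\<close>, and the
  Lipschitz bound keeps \<open>f\<close> away from \<open>0\<close> on an interval around \<open>s\<close> of length proportional to
  \<open>\<bar>s - t\<bar>\<close>. So the zero set is porous at \<open>t\<close>.\<close>

lemma Lipschitz_has_derivative_0_at_ae_zero:
  fixes f :: "real \<Rightarrow> 'b::real_normed_vector"
  assumes lip: "\<And>s t. s \<in> {a..b} \<Longrightarrow> t \<in> {a..b} \<Longrightarrow> norm (f s - f t) \<le> L * \<bar>s - t\<bar>"
    and L: "L > 0"
  shows "negligible {t \<in> {a..b}. f t = 0 \<and> \<not> (f has_vector_derivative 0) (at t within {a..b})}"
proof -
  define Z where "Z = {t \<in> {a..b}. f t = 0}"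
  define E where "E \<epsilon> = {t \<in> Z. \<forall>d>0. \<exists>s\<in>{a..b}. \<bar>s - t\<bar> < d \<and> norm (f s) > \<epsilon> * \<bar>s - t\<bar>}" for \<epsilon>
  have "L-lipschitz_on {a..b} f"
    using lip L by (auto simp: lipschitz_on_def dist_norm)
  then have "continuous_on {a..b} f" by (rule lipschitz_on_continuous_on)
  then have "closed Z"
    unfolding Z_def using continuous_closed_preimage_constant closed_real_atLeastAtMost by blast
  then have Z: "Z \<in> sets lebesgue" by (simp add: borel_closed)
  have neg: "negligible (E \<epsilon>)" if \<epsilon>: "\<epsilon> > 0" for \<epsilon>
  proof (rule negligible_if_porous_in[OF Z])
    show "E \<epsilon> \<subseteq> Z" by (auto simp: E_def)
    show "\<epsilon> / (4 * L) > 0" using \<epsilon> L by simp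
    fix t d :: real assume t: "t \<in> E \<epsilon>" and "d > 0"
    \<comment> \<open>Half of \<open>d\<close>, because the ball around \<open>t\<close> used below has radius \<open>2 * \<bar>s - t\<bar>\<close>.\<close>
    then obtain s where s: "s \<in> {a..b}" "\<bar>s - t\<bar> < d / 2" and fs: "norm (f s) > \<epsilon> * \<bar>s - t\<bar>"
      unfolding E_def using half_gt_zero by blast
    have tZ: "t \<in> {a..b}" "f t = 0" using t by (auto simp: E_def Z_def)
    have "s \<noteq> t" using fs tZ by auto
    define r where "r = \<bar>s - t\<bar>"
    have "r > 0" using \<open>s \<noteq> t\<close> by (simp add: r_def)
    have "\<epsilon> * r < L * r" using lip[OF s(1) tZ(1)] fs tZ(2) by (simp add: r_def)
    then have "\<epsilon> < L" using \<open>r > 0\<close> by simp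
    \<comment> \<open>The hole is placed on the side of \<open>s\<close> that faces \<open>t\<close>, which keeps it inside \<open>{a..b}\<close>.\<close>
    define c where "c = s + (\<epsilon> * r / (2 * L)) * sgn (t - s)"
    have q: "\<epsilon> / (4 * L) * (2 * r) = \<epsilon> * r / (2 * L)" by simp
    have half: "\<epsilon> * r / (2 * L) < r / 2" "0 < \<epsilon> * r / (2 * L)"
      using \<open>\<epsilon> < L\<close> \<open>r > 0\<close> L \<epsilon> by (auto simp: field_simps)
    have near: "x \<in> {min s t..max s t} \<and> \<bar>x - s\<bar> < \<epsilon> * r / L"
      if "x \<in> ball c (\<epsilon> * r / (2 * L))" for x
    proof -
      have x: "\<bar>x - c\<bar> < \<epsilon> * r / (2 * L)" using that by (simp add: dist_real_def abs_minus_commute)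
      have e: "\<epsilon> * r / L = 2 * (\<epsilon> * r / (2 * L))" by simp
      show ?thesis
      proof (cases "s < t")
        case True
        then have "c = s + \<epsilon> * r / (2 * L)" "r = t - s" by (auto simp: c_def r_def)
        with x half e True show ?thesis unfolding atLeastAtMost_iff by linarith
      next
        case False
        then have "c = s - \<epsilon> * r / (2 * L)" "r = s - t" using \<open>s \<noteq> t\<close> by (auto simp: c_def r_def)
        with x half e False show ?thesis unfolding atLeastAtMost_iff by linarith
      qed
    qed
    have "ball c (\<epsilon> * r / (2 * L)) \<subseteq> ball t (2 * r) - Z"
    proof
      fix x assume "x \<in> ball c (\<epsilon> * r / (2 * L))"
      then have x: "x \<in> {min s t..max s t}" "\<bar>x - s\<bar> < \<epsilon> * r / L" using near by auto
      have "dist t x < 2 * r" using x(1) \<open>s \<noteq> t\<close>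
        by (cases "s \<le> t") (auto simp: dist_real_def r_def)
      moreover have "x \<in> {a..b}" using x(1) s(1) tZ(1) by auto
      have "norm (f s - f x) \<le> L * \<bar>s - x\<bar>" by (rule lip) (use s \<open>x \<in> {a..b}\<close> in auto)
      moreover have "L * \<bar>s - x\<bar> < \<epsilon> * r"
        using x(2) L by (simp add: field_simps abs_minus_commute)
      ultimately have "f x \<noteq> 0" using fs by (auto simp: r_def)
      then show "x \<in> ball t (2 * r) - Z" using \<open>dist t x < 2 * r\<close> by (auto simp: Z_def)
    qed
    then have "0 < 2 * r \<and> 2 * r < d \<and> ball c (\<epsilon> / (4 * L) * (2 * r)) \<subseteq> ball t (2 * r) - Z"
      using \<open>r > 0\<close> s(2) unfolding q by (auto simp: r_def)
    then show "\<exists>r c. 0 < r \<and> r < d \<and> ball c (\<epsilon> / (4 * L) * r) \<subseteq> ball t r - Z" by blast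
  qed
  have "{t \<in> {a..b}. f t = 0 \<and> \<not> (f has_vector_derivative 0) (at t within {a..b})}
      \<subseteq> (\<Union>n. E (1 / real (Suc n)))"
  proof clarify
    fix t assume t: "t \<in> {a..b}" "f t = 0" and nd: "\<not> (f has_vector_derivative 0) (at t within {a..b})"
    show "t \<in> (\<Union>n. E (1 / real (Suc n)))"
    proof (rule ccontr)
      assume not: "t \<notin> (\<Union>n. E (1 / real (Suc n)))"
      have "(f has_vector_derivative 0) (at t within {a..b})"
        unfolding has_vector_derivative_def has_derivative_within_alt
      proof (intro conjI allI impI)
        fix e :: real assume "e > 0"
        then obtain n where n: "1 / real (Suc n) < e" using nat_approx_posE by blast
        have "t \<notin> E (1 / real (Suc n))" using not by blast
        then obtain d where "d > 0"
          and d: "\<And>s. s \<in> {a..b} \<Longrightarrow> \<bar>s - t\<bar> < d \<Longrightarrow> norm (f s) \<le> 1 / real (Suc n) * \<bar>s - t\<bar>"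
          using t unfolding E_def Z_def mem_Collect_eq by (metis not_less)
        have "norm (f s) \<le> e * \<bar>s - t\<bar>" if "s \<in> {a..b}" "\<bar>s - t\<bar> < d" for s
          using d[OF that] n mult_right_mono[of "1 / real (Suc n)" e "\<bar>s - t\<bar>"] by linarith
        then show "\<exists>d>0. \<forall>y\<in>{a..b}. norm (y - t) < d \<longrightarrow>
            norm (f y - f t - (y - t) *\<^sub>R 0) \<le> e * norm (y - t)"
          using t \<open>d > 0\<close> by auto
      qed (simp add: bounded_linear_zero)
      with nd show False by contradiction
    qed
  qed
  moreover have "negligible (\<Union>n. E (1 / real (Suc n)))"
    by (intro negligible_Union_nat neg) simp
  ultimately show ?thesis using negligible_subset by blast
qed

section \<open>The Filippov set of the right-hand side\<close>

text \<open>The complement of a null set is dense, so discarding a null set does not lose the values of \<open>g\<close> at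
  points of continuity. This is how all statements about Filippov sets below deal with \<open>N\<close>.\<close>

lemma isCont_value_in_closed:
  fixes g :: "'a::euclidean_space \<Rightarrow> 'b::topological_space"
  assumes g: "isCont g y" and U: "open U" "y \<in> U" and N: "N \<in> null_sets lebesgue"
    and S: "closed S" "g ` (U - N) \<subseteq> S"
  shows "g y \<in> S"
proof (rule ccontr)
  assume "g y \<notin> S"
  then obtain W where W: "open W" "y \<in> W" "\<forall>x\<in>W. g x \<in> - S"
    using g S(1) unfolding continuous_at_open by (metis Compl_iff open_Compl)
  then have "U \<inter> W \<subseteq> N" using S(2) by auto
  then have "negligible (U \<inter> W)"
    using N negligible_iff_null_sets negligible_subset by blast
  then show False
    using open_not_negligible[of "U \<inter> W"] U W by blast
qed

lemma filippov_setI: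
  assumes "\<And>\<delta> N S. \<delta> > 0 \<Longrightarrow> N \<in> null_sets lebesgue \<Longrightarrow> closed S \<Longrightarrow> convex S \<Longrightarrow>
    f t ` (ball y \<delta> - N) \<subseteq> S \<Longrightarrow> v \<in> S"
  shows "v \<in> filippov_set UNIV f t y"
  using assms by (auto simp: filippov_set_def closed_convex_hull_def hull_def)

lemma rhs_F_nonzero: "u \<noteq> 0 \<Longrightarrow> rhs_F \<sigma> V' c t u = - (\<sigma> *\<^sub>R sgn u) - V' t"
  by (simp add: rhs_F_def sgn_div_norm)

lemma isCont_rhs_F:
  assumes "u \<noteq> 0"
  shows "isCont (rhs_F \<sigma> V' c t) u"
proof -
  have "\<forall>\<^sub>F y in nhds u. y \<noteq> 0" using assms by (rule t1_space_nhds)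
  then have "\<forall>\<^sub>F y in nhds u. rhs_F \<sigma> V' c t y = - (\<sigma> *\<^sub>R sgn y) - V' t"
    by eventually_elim (rule rhs_F_nonzero)
  then show ?thesis
    by (subst isCont_cong) (auto intro!: continuous_intros assms)
qed

lemma rhs_F_in_filippov_set:
  assumes "u \<noteq> 0"
  shows "rhs_F \<sigma> V' c t u \<in> filippov_set UNIV (rhs_F \<sigma> V' c) t u"
  by (rule filippov_setI)
     (rule isCont_value_in_closed[OF isCont_rhs_F[OF assms] open_ball], auto)

text \<open>Arbitrarily close to the origin the right-hand side takes all values \<open>- \<sigma> *\<^sub>R a - V' t\<close> with \<open>a\<close> a
  unit vector, so the Filippov set at the origin is the closed ball of radius \<open>\<sigma>\<close> around \<open>- V' t\<close>. The
  proof exhibits \<open>0\<close> as a convex combination of the two end points of the diameter through it.\<close>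

lemma zero_in_filippov_set_rhs_F:
  assumes \<sigma>: "\<sigma> > 0" and V': "norm (V' t) \<le> \<sigma>"
  shows "0 \<in> filippov_set UNIV (rhs_F \<sigma> V' c) t 0"
proof (rule filippov_setI)
  fix \<delta> :: real and N S :: "(real^2) set"
  assume \<delta>: "\<delta> > 0" and N: "N \<in> null_sets lebesgue" and S: "closed S" "convex S"
    and sub: "rhs_F \<sigma> V' c t ` (ball 0 \<delta> - N) \<subseteq> S"
  obtain e :: "real^2" where e: "norm e = 1" "V' t = norm (V' t) *\<^sub>R e"
  proof (cases "V' t = 0")
    case True
    then show thesis using that vector_choose_size[of 1] by auto
  next
    case False
    then show thesis using that[of "sgn (V' t)"] by (simp add: sgn_div_norm)
  qed
  have in_S: "- \<sigma> *\<^sub>R a - V' t \<in> S" if "norm a = 1" for a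
  proof -
    have "(\<delta> / 2) *\<^sub>R a \<noteq> 0" "(\<delta> / 2) *\<^sub>R a \<in> ball 0 \<delta>" using that \<delta> by auto
    then have "rhs_F \<sigma> V' c t ((\<delta> / 2) *\<^sub>R a) \<in> S"
      using isCont_value_in_closed[OF isCont_rhs_F open_ball _ N S(1) sub] by blast
    moreover have "sgn ((\<delta> / 2) *\<^sub>R a) = a" using that \<delta> by (simp add: sgn_div_norm)
    ultimately show ?thesis using \<open>(\<delta> / 2) *\<^sub>R a \<noteq> 0\<close> by (simp add: rhs_F_nonzero)
  qed
  define m where "m = norm (V' t)"
  have "((1 - m / \<sigma>) / 2) *\<^sub>R (- \<sigma> *\<^sub>R e - V' t) + ((1 + m / \<sigma>) / 2) *\<^sub>R (- \<sigma> *\<^sub>R (- e) - V' t) \<in> S"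
  proof (rule convexD[OF S(2)])
    show "- \<sigma> *\<^sub>R e - V' t \<in> S" "- \<sigma> *\<^sub>R (- e) - V' t \<in> S"
      by (rule in_S, simp add: e)+
    show "0 \<le> (1 - m / \<sigma>) / 2" "0 \<le> (1 + m / \<sigma>) / 2"
      using \<sigma> V' by (auto simp: m_def field_simps)
    show "(1 - m / \<sigma>) / 2 + (1 + m / \<sigma>) / 2 = 1"
      by (simp add: field_simps)
  qed
  also have "((1 - m / \<sigma>) / 2) *\<^sub>R (- \<sigma> *\<^sub>R e - V' t) + ((1 + m / \<sigma>) / 2) *\<^sub>R (- \<sigma> *\<^sub>R (- e) - V' t)
      = (((1 - m / \<sigma>) / 2) * (- \<sigma> - m) + ((1 + m / \<sigma>) / 2) * (\<sigma> - m)) *\<^sub>R e"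
  proof -
    have "- \<sigma> *\<^sub>R e - V' t = (- \<sigma> - m) *\<^sub>R e" "- \<sigma> *\<^sub>R (- e) - V' t = (\<sigma> - m) *\<^sub>R e"
      by (subst e(2), simp add: m_def algebra_simps)+
    then show ?thesis by (simp only: scaleR_scaleR scaleR_left_distrib)
  qed
  also have "((1 - m / \<sigma>) / 2) * (- \<sigma> - m) + ((1 + m / \<sigma>) / 2) * (\<sigma> - m) = 0"
    using \<sigma> by (simp add: field_simps)
  finally show "0 \<in> S" by simp
qed

text \<open>Off the null set where \<open>y = 0\<close> the right-hand side is continuous, and Lebesgue measurability
  ignores null sets.\<close>

lemma measurable_rhs_F:
  assumes "continuous_on {t1..t2} V'"
  shows "(\<lambda>(t, y). rhs_F \<sigma> V' c t y) \<in> borel_measurable (lebesgue_on ({t1..t2} \<times> UNIV))"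
proof -
  let ?f = "\<lambda>(t, y). rhs_F \<sigma> V' c t y"
  let ?S = "{t1..t2} \<times> (UNIV :: (real^2) set)" and ?N = "{t1..t2} \<times> {0 :: real^2}"
  have S: "?S \<in> sets lebesgue"
  proof -
    have "closed ?S" by (intro closed_Times) auto
    then show ?thesis by (simp add: borel_closed)
  qed
  obtain b :: "real^2" where "b \<in> Basis" using nonempty_Basis by blast
  then have "negligible {z :: real \<times> (real^2). (0, b) \<bullet> z = 0}"
    by (intro negligible_hyperplane) (auto simp: zero_prod_def nonzero_Basis)
  then have "negligible ?N" by (rule negligible_subset) auto
  then have "?N \<in> null_sets (lebesgue_on ?S)"
    using null_sets_restrict_space[OF S] negligible_iff_null_sets by blast
  moreover have "?f \<in> borel_measurable (lebesgue_on (?S - ?N))"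
  proof (rule continuous_imp_measurable_on_sets_lebesgue)
    have "continuous_on (?S - ?N) (\<lambda>z. - (\<sigma> *\<^sub>R sgn (snd z)) - V' (fst z))"
      by (intro continuous_intros continuous_on_compose2[OF assms continuous_on_fst[OF continuous_on_id]])
         auto
    then show "continuous_on (?S - ?N) ?f"
      by (rule continuous_on_eq) (auto intro!: rhs_F_nonzero[symmetric])
    show "?S - ?N \<in> sets lebesgue"
      using S \<open>negligible ?N\<close> negligible_imp_sets by blast
  qed
  ultimately show ?thesis
    using borel_measurable_diff_null[OF _ S] by blast
qed

section \<open>Existence of a periodic solution\<close>

theorem mainTheorem1:
  fixes \<sigma> :: real and V V' c :: "real \<Rightarrow> real^2"
  assumes "\<sigma> > 0"
    and "\<And>t. t \<ge> 0 \<Longrightarrow> (V has_vector_derivative V' t) (at t within {0..})"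
    and "continuous_on {0..} V'"
    and "\<And>t. t \<ge> 0 \<Longrightarrow> V (t + 1) = V t"
    and "(SUP t\<in>{0..1}. norm (V' t)) \<noteq> 0"
    and "c \<in> borel_measurable (lebesgue_on {0..})"
  shows "\<exists>u :: real \<Rightarrow> real^2.
           generalized_solution UNIV (rhs_F \<sigma> V' c) u \<and> (\<forall>t\<ge>0. u (t + 1) = u t)"
proof -
  note \<sigma> = assms(1) and derV = assms(2) and contV' = assms(3) and perV = assms(4)
  have contV: "continuous_on {0..} V"
    using derV by (intro continuous_on_vector_derivative[of _ _ V']) auto
  obtain w where w_per: "\<And>t. t \<ge> 0 \<Longrightarrow> w (t + 1) = w t"
    and w_lip: "\<And>s t. norm (w s - w t) \<le> \<sigma> * \<bar>s - t\<bar>"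
    and w_der: "\<And>t. t \<ge> 0 \<Longrightarrow> w t \<noteq> V t \<Longrightarrow>
       (w has_vector_derivative - \<sigma> *\<^sub>R sgn (w t - V t)) (at t within {0..})"
    by (rule periodic_pursuit_curve_exists[OF \<sigma> contV perV]) (assumption, rule that)
  define u where "u t = w t - V t" for t
  have "generalized_solution_on t1 t2 UNIV (rhs_F \<sigma> V' c) u" if t12: "0 \<le> t1" "t1 < t2" for t1 t2
  proof -
    let ?I = "{t1..t2}"
    have sub: "?I \<subseteq> {0..}" using t12 by auto
    have derVI: "(V has_vector_derivative V' t) (at t within ?I)" if "t \<in> ?I" for t
      using derV sub that has_vector_derivative_within_subset by blast
    have contV'I: "continuous_on ?I V'" using contV' sub continuous_on_subset by blast
    then have "bounded (V' ` ?I)"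
      by (intro compact_imp_bounded compact_continuous_image) auto
    then obtain M where "M > 0" and M: "\<And>t. t \<in> ?I \<Longrightarrow> norm (V' t) \<le> M"
      unfolding bounded_pos by blast
    have lip: "norm (u s - u t) \<le> (\<sigma> + M) * \<bar>s - t\<bar>" if st: "s \<in> ?I" "t \<in> ?I" for s t
    proof -
      have "norm (V s - V t) \<le> M * \<bar>s - t\<bar>"
        by (rule Lipschitz_if_vector_derivative_bounded[OF _ derVI M st]) auto
      moreover have "norm (u s - u t) \<le> norm (w s - w t) + norm (V s - V t)"
        using norm_triangle_ineq4[of "w s - w t" "V s - V t"] by (simp add: u_def algebra_simps)
      ultimately show ?thesis using w_lip[of s t] by (simp add: algebra_simps)
    qed
    have pos: "\<sigma> + M > 0" using \<sigma> \<open>M > 0\<close> by simp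
    define B where "B = {t \<in> ?I. u t = 0 \<and> \<not> (u has_vector_derivative 0) (at t within ?I)}"
    have "negligible B"
      unfolding B_def by (rule Lipschitz_has_derivative_0_at_ae_zero[OF lip pos])
    then have B: "B \<in> null_sets (lebesgue_on ?I)"
      by (subst null_sets_restrict_space) (auto simp: B_def negligible_iff_null_sets)
    have "\<exists>v. (u has_vector_derivative v) (at t within ?I) \<and>
        v \<in> filippov_set UNIV (rhs_F \<sigma> V' c) t (u t)" if t: "t \<in> ?I" "t \<notin> B" for t
    proof (cases "u t = 0")
      case False
      have "(w has_vector_derivative - \<sigma> *\<^sub>R sgn (u t)) (at t within ?I)"
        using has_vector_derivative_within_subset[OF w_der sub, of t] False t(1) sub
        by (auto simp: u_def)
      from has_vector_derivative_diff[OF this derVI[OF t(1)]]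
      have "(u has_vector_derivative rhs_F \<sigma> V' c t (u t)) (at t within ?I)"
        using False by (simp add: u_def[abs_def] rhs_F_nonzero)
      then show ?thesis using rhs_F_in_filippov_set[OF False] by blast
    next
      \<comment> \<open>At almost every zero of \<open>u\<close> the curves \<open>w\<close> and \<open>V\<close> have the same velocity, so the speed
        limit on \<open>w\<close> becomes the bound on \<open>V'\<close> that puts \<open>0\<close> into the Filippov set.\<close>
      case True
      then have u0: "(u has_vector_derivative 0) (at t within ?I)" using t by (auto simp: B_def)
      have "(w has_vector_derivative V' t) (at t within ?I)"
        using has_vector_derivative_add[OF u0 derVI[OF t(1)]] by (simp add: u_def)
      then have "norm (V' t) \<le> \<sigma>"
        by (rule norm_vector_derivative_le_Lipschitz) (use t t12 w_lip in auto)
      then show ?thesis using u0 True zero_in_filippov_set_rhs_F[OF \<sigma>] by auto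
    qed
    then have "AE t in lebesgue_on ?I. \<exists>v. (u has_vector_derivative v) (at t within ?I) \<and>
        v \<in> filippov_set UNIV (rhs_F \<sigma> V' c) t (u t)"
      by (intro AE_I'[OF B]) (auto simp: space_lebesgue_on)
    moreover have "abs_continuous_on_interval t1 t2 u"
      by (rule Lipschitz_imp_abs_continuous_on_interval[OF lip pos])
    ultimately show ?thesis
      unfolding generalized_solution_on_def using measurable_rhs_F[OF contV'I]
      by (simp add: convex_connected)
  qed
  then have "generalized_solution UNIV (rhs_F \<sigma> V' c) u"
    by (simp add: generalized_solution_def)
  moreover have "\<forall>t\<ge>0. u (t + 1) = u t" by (simp add: u_def w_per perV)
  ultimately show ?thesis by blast
qed

end
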